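(* In the homogeneous case, i.e. $\rho>0$ constant and $\mathbf{E}=(E_{klmn})$ constant, and for polynomial degree $p_\gamma=0$ in time (Crank--Nicolson time discretization), the global matrix $\mathbf{A}$ of the discrete velocity system, defined in the context, is positive definite: $\hat v^\top\mathbf{A}\hat v>0$ for every $\hat v\neq 0$.
   Context: Let $d\in\{2,3\}$. Repeated indices are summed unless $i,j$ (element and face numbers). The stiffness tensor has the symmetries $E_{klmn}=E_{lkmn}=E_{klnm}=E_{mnkl}$ (written $\mathbf{E}=\mathbf{E}^\top$) and is positive definite on symmetric tensors ($\mathbf{E}>0$): $E_{klmn}\epsilon_{kl}\epsilon_{mn}>0$ for every symmetric $d\times d$ tensor $\epsilon\ne0$. **Mesh.** $\Omega\subset\mathbb{R}^d$ is covered by a conforming mesh of $N_i$ non-overlapping simplices $T_i$, $i=1,\dots,N_i$ (triangles if $d=2$, tetrahedra if $d=3$), with $N_j$ faces $\Gamma_j$ (edges if $d=2$). $S_i$ is the set of indices $j$ such that $\Gamma_j$ is a face of $T_i$. Every face is shared by exactly two distinct elements (boundary faces are identified periodically), arbitrarily called left, $T_{\ell(j)}$, and right, $T_{r(j)}$. For $j\in S_i$, $\wp(i,j)$ is the index of the other element sharing $\Gamma_j$. $\mathbf{n}_j$ is the unit normal on $\Gamma_j$ pointing from left to right, and $\mathbf{n}_{i,j}$ is the unit normal on $\Gamma_j$ outward with respect to $T_i$. For $j\in S_i$, $T_{i,j}\subset T_i$ is the sub-simplex spanned by $\Gamma_j$ and the barycenter of $T_i$. The dual element of $\Gamma_j$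 is $R_j=T_{\ell(j),j}\cup T_{r(j),j}$, so $T_{i,j}=R_j\cap T_i$; the dual elements also cover $\Omega$. **Basis functions.** Fix a degree $p\ge 0$ in space. $\{\phi^{(i)}_\mu\}_{\mu=1}^{N_\phi}$ is the nodal polynomial basis of degree $p$ on $T_i$ (defined on the reference simplex and mapped to $T_i$). $\{\psi^{(j)}_\kappa\}_{\kappa=1}^{N_\psi}$ is a basis of degree $p$ on $R_j$: for $d=2$ the tensor-product nodal basis on $[0,1]^2$ mapped to the quadrilateral $R_j$; for $d=3$ the rescaled Taylor monomials of total degree at most $p$ in physical space. The basis functions are linearly independent and smooth on the elements. For $p_\gamma=0$ the space-time basis functions on $T_i\times[t^n,t^{n+1}]$ and $R_j\times[t^n,t^{n+1}]$ are these functions, constant in time; $\Delta t=t^{n+1}-t^n>0$. **Matrices** (Greek upper indices: basis and test functions; Latin lower indices: spatial components): $$(\bar M_i)^{\mu\nu}=\int_{T_i}\phi^{(i)}_\mu\phi^{(i)}_\nu\,d\mathbf{x},\qquad (M_j)^{\kappa\alpha}=\int_{R_j}\psi^{(j)}_\kappa\psi^{(j)}_\alpha\,d\mathbf{x},$$ $$(D_{i,j})^{\mu\kappa}_m=\int_{t^n}^{t^{n+1}}\Big(\int_{\Gamma_j}\phi^{(i)}_\mu\psi^{(j)}_\kappa\,(n_{i,j})_m\,dS-\int_{T_{i,j}}\partial_m\phi^{(i)}_\mu\,\psi^{(j)}_\kappa\,d\mathbf{x}\Big)dt,$$ $$(\tilde Q_{i,j})^{\kappa\mu}_m=\int_{t^n}^{t^{n+1}}\Big(\int_{T_{i,j}}\psi^{(j)}_\kappa\,\partial_m\phi^{(i)}_\mu\,d\mathbf{x}-\int_{\Gamma_j}\psi^{(j)}_\kappa\phi^{(i)}_\mu\,s_{i,j}\,(n_j)_m\,dS\Big)dt,$$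 with $s_{i,j}=\frac{r(j)-2i+\ell(j)}{r(j)-\ell(j)}$, i.e. $s_{i,j}=1$ if $i=\ell(j)$ and $s_{i,j}=-1$ if $i=r(j)$. **Velocity system.** The unknowns are the coefficients $\hat v^{\nu}_{i,l}$ ($1\le i\le N_i$, $1\le\nu\le N_\phi$, $1\le l\le d$). The matrix $\mathbf{A}$, of size $N_iN_\phi d$, is defined by $$(\mathbf{A}\hat v)^{\mu}_{i,k}=\rho\,(\bar M_i)^{\mu\nu}\hat v^\nu_{i,k}-\frac14\sum_{j\in S_i}(D_{i,j})^{\mu\kappa}_q\,(M_j^{-1})^{\kappa\alpha}\,E_{kqlm}\Big((\tilde Q_{i,j})^{\alpha\nu}_m\hat v^\nu_{i,l}+(\tilde Q_{\wp(i,j),j})^{\alpha\nu}_m\hat v^\nu_{\wp(i,j),l}\Big).$$ *)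

theory Defs
  imports "HOL-Analysis.Analysis"
begin

subsection \<open>Meshes\<close>

text \<open>
  Elements and faces are indexed by finite types \<open>'e\<close> and \<open>'j\<close>; the field \<open>elem_no\<close> carries the
  numbers \<open>1, \<dots>, N\<close> of the elements. The vertices of an element are indexed by \<open>'d option\<close>:
  \<open>None\<close> corresponds to the origin of the reference simplex and \<open>Some k\<close> to its \<open>k\<close>-th unit vector.

  Periodic identification: \<open>fvert j\<close> are the vertices of a face as seen from its left element, and
  translating them by \<open>period j\<close> gives the corresponding face of the right element. The translation
  is zero for a face in the interior of the domain.
\<close>

record ('d::finite, 'e, 'j) mesh =
  elem_no :: "'e \<Rightarrow> nat"
  vert :: "'e \<Rightarrow> 'd option \<Rightarrow> real^'d"
  fvert :: "'j \<Rightarrow> (real^'d) set"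
  lft :: "'j \<Rightarrow> 'e"
  rgt :: "'j \<Rightarrow> 'e"
  period :: "'j \<Rightarrow> real^'d"

definition element :: "('d::finite, 'e, 'j) mesh \<Rightarrow> 'e \<Rightarrow> (real^'d) set" where
  "element M i = convex hull range (vert M i)"

definition facet_vertices :: "('d::finite, 'e, 'j) mesh \<Rightarrow> 'e \<Rightarrow> (real^'d) set set" where
  "facet_vertices M i = {vert M i ` (- {a}) | a. True}"

definition face :: "('d::finite, 'e, 'j) mesh \<Rightarrow> 'j \<Rightarrow> (real^'d) set" where
  "face M j = convex hull fvert M j"

text \<open>
  Everything attached to a face \<open>j\<close> is expressed in the coordinates of its left element; the copy of
  \<open>T\<^sub>i\<close> adjacent to \<open>\<Gamma>\<^sub>j\<close> is obtained from \<open>T\<^sub>i\<close> by subtracting \<open>offset M i j\<close>.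
\<close>

definition offset :: "('d::finite, 'e, 'j) mesh \<Rightarrow> 'e \<Rightarrow> 'j \<Rightarrow> real^'d" where
  "offset M i j = (if i = lft M j then 0 else period M j)"

definition element_at :: "('d::finite, 'e, 'j) mesh \<Rightarrow> 'e \<Rightarrow> 'j \<Rightarrow> (real^'d) set" where
  "element_at M i j = (\<lambda>x. x - offset M i j) ` element M i"

definition is_face_of_element :: "('d::finite, 'e, 'j) mesh \<Rightarrow> 'j \<Rightarrow> 'e \<Rightarrow> (real^'d) set \<Rightarrow> bool" where
  "is_face_of_element M j i F \<longleftrightarrow>
     (i = lft M j \<and> F = fvert M j) \<or> (i = rgt M j \<and> F = (+) (period M j) ` fvert M j)"

definition periodic_simplicial_mesh ::
    "(real^'d) set \<Rightarrow> ('d::finite, 'e::finite, 'j::finite) mesh \<Rightarrow> bool" where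
  "periodic_simplicial_mesh \<Omega> M \<longleftrightarrow>
     bij_betw (elem_no M) UNIV {1..CARD('e)} \<and>
     (\<forall>i. inj (vert M i) \<and> \<not> affine_dependent (range (vert M i))) \<and>
     closure \<Omega> = (\<Union>i. element M i) \<and>
     (\<forall>i k. i \<noteq> k \<longrightarrow> interior (element M i) \<inter> interior (element M k) = {}) \<and>
     (\<forall>i k. (element M i \<inter> element M k) face_of element M i) \<and>
     (\<forall>j. lft M j \<noteq> rgt M j \<and>
          fvert M j \<in> facet_vertices M (lft M j) \<and>
          (+) (period M j) ` fvert M j \<in> facet_vertices M (rgt M j)) \<and>
     (\<forall>i. \<forall>F \<in> facet_vertices M i. \<exists>!j. is_face_of_element M j i F) \<and>
     (\<forall>j. period M j \<noteq> 0 \<longrightarrow>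
          face M j \<subseteq> frontier \<Omega> \<and> (+) (period M j) ` face M j \<subseteq> frontier \<Omega>) \<and>
     (\<forall>j. interior (element_at M (lft M j) j) \<inter> interior (element_at M (rgt M j) j) = {})"

definition faces_of :: "('d::finite, 'e, 'j) mesh \<Rightarrow> 'e \<Rightarrow> 'j set" where
  "faces_of M i = {j. i = lft M j \<or> i = rgt M j}"

definition neighbour :: "('d::finite, 'e, 'j) mesh \<Rightarrow> 'e \<Rightarrow> 'j \<Rightarrow> 'e" where
  "neighbour M i j = (if i = lft M j then rgt M j else lft M j)"

definition side_sign :: "('d::finite, 'e, 'j) mesh \<Rightarrow> 'e \<Rightarrow> 'j \<Rightarrow> real" where
  "side_sign M i j =
     (real (elem_no M (rgt M j)) - 2 * real (elem_no M i) + real (elem_no M (lft M j))) /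
     (real (elem_no M (rgt M j)) - real (elem_no M (lft M j)))"

definition unit_normal_to :: "(real^'d::finite) set \<Rightarrow> real^'d \<Rightarrow> bool" where
  "unit_normal_to F n \<longleftrightarrow> norm n = 1 \<and> (\<forall>x\<in>F. \<forall>y\<in>F. n \<bullet> (x - y) = 0)"

definition face_normal :: "('d::finite, 'e, 'j) mesh \<Rightarrow> 'j \<Rightarrow> real^'d" where
  "face_normal M j = (THE n. unit_normal_to (face M j) n \<and>
     (\<forall>y\<in>face M j. (\<forall>x\<in>element_at M (lft M j) j. n \<bullet> (x - y) \<le> 0) \<and>
                    (\<forall>x\<in>element_at M (rgt M j) j. n \<bullet> (x - y) \<ge> 0)))"

definition outward_normal :: "('d::finite, 'e, 'j) mesh \<Rightarrow> 'e \<Rightarrow> 'j \<Rightarrow> real^'d" where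
  "outward_normal M i j = (THE n. unit_normal_to (face M j) n \<and>
     (\<forall>y\<in>face M j. \<forall>x\<in>element_at M i j. n \<bullet> (x - y) \<le> 0))"

definition barycenter :: "('d::finite, 'e, 'j) mesh \<Rightarrow> 'e \<Rightarrow> real^'d" where
  "barycenter M i = (1 / real (CARD('d) + 1)) *\<^sub>R (\<Sum>a\<in>UNIV. vert M i a)"

definition subelement :: "('d::finite, 'e, 'j) mesh \<Rightarrow> 'e \<Rightarrow> 'j \<Rightarrow> (real^'d) set" where
  "subelement M i j = convex hull insert (barycenter M i - offset M i j) (fvert M j)"

definition dual_element :: "('d::finite, 'e, 'j) mesh \<Rightarrow> 'j \<Rightarrow> (real^'d) set" where
  "dual_element M j = subelement M (lft M j) j \<union> subelement M (rgt M j) j"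


subsection \<open>Calculus\<close>

definition partial_deriv :: "'d::finite \<Rightarrow> (real^'d \<Rightarrow> real) \<Rightarrow> real^'d \<Rightarrow> real" where
  "partial_deriv m f x = frechet_derivative f (at x) (axis m 1)"

text \<open>
  Integral over a subset \<open>F\<close> of a hyperplane with respect to surface measure. The slab of thickness
  one around \<open>F\<close> is the orthogonal product of \<open>F\<close> with an interval of length one, and
  \<open>closest_point (affine hull F)\<close> is the orthogonal projection onto the hyperplane, so by Fubini the
  volume integral below is the \<open>(d - 1)\<close>-dimensional integral of \<open>f\<close> over \<open>F\<close>.
\<close>

definition surface_integral :: "(real^'d::finite) set \<Rightarrow> (real^'d \<Rightarrow> real) \<Rightarrow> real" where
  "surface_integral F f =
     (LINT x : {x. closest_point (affine hull F) x \<in> F \<and>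
                   dist x (closest_point (affine hull F) x) \<le> 1/2} | lborel.
        f (closest_point (affine hull F) x))"

primrec C_k_on :: "nat \<Rightarrow> (real^'d::finite) set \<Rightarrow> (real^'d \<Rightarrow> real) \<Rightarrow> bool" where
  "C_k_on 0 U f \<longleftrightarrow> continuous_on U f"
| "C_k_on (Suc n) U f \<longleftrightarrow>
     (\<forall>x\<in>U. f differentiable (at x)) \<and> (\<forall>m. C_k_on n U (partial_deriv m f))"

definition smooth_on_set :: "(real^'d::finite) set \<Rightarrow> (real^'d \<Rightarrow> real) \<Rightarrow> bool" where
  "smooth_on_set S f \<longleftrightarrow>
     (\<exists>U g. open U \<and> S \<subseteq> U \<and> (\<forall>x\<in>S. g x = f x) \<and> (\<forall>n. C_k_on n U g))"

definition lin_indep_on :: "'x set \<Rightarrow> ('b::finite \<Rightarrow> 'x \<Rightarrow> real) \<Rightarrow> bool" where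
  "lin_indep_on S f \<longleftrightarrow>
     (\<forall>c. (\<forall>x\<in>S. (\<Sum>b\<in>UNIV. c b * f b x) = 0) \<longrightarrow> (\<forall>b. c b = 0))"


subsection \<open>Basis functions\<close>

definition total_degree_indices :: "nat \<Rightarrow> ('d::finite \<Rightarrow> nat) set" where
  "total_degree_indices p = {a. (\<Sum>k\<in>UNIV. a k) \<le> p}"

definition tensor_indices :: "nat \<Rightarrow> ('d::finite \<Rightarrow> nat) set" where
  "tensor_indices p = {a. \<forall>k. a k \<le> p}"

definition monomial_at :: "real^'d::finite \<Rightarrow> ('d \<Rightarrow> nat) \<Rightarrow> real^'d \<Rightarrow> real" where
  "monomial_at z a x = (\<Prod>k\<in>UNIV. (x $ k - z $ k) ^ a k)"

definition polynomials_over :: "('d::finite \<Rightarrow> nat) set \<Rightarrow> (real^'d \<Rightarrow> real) set" where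
  "polynomials_over I = {f. \<exists>c. \<forall>x. f x = (\<Sum>a\<in>I. c a * monomial_at 0 a x)}"

definition reference_simplex :: "(real^'d::finite) set" where
  "reference_simplex = {x. (\<forall>k. 0 \<le> x $ k) \<and> (\<Sum>k\<in>UNIV. x $ k) \<le> 1}"

definition nodal_basis ::
    "nat \<Rightarrow> ('f::finite \<Rightarrow> real^'d::finite) \<Rightarrow> ('f \<Rightarrow> real^'d \<Rightarrow> real) \<Rightarrow> bool" where
  "nodal_basis p \<xi> \<theta> \<longleftrightarrow>
     range \<xi> \<subseteq> reference_simplex \<and>
     (\<forall>\<mu>. \<theta> \<mu> \<in> polynomials_over (total_degree_indices p)) \<and>
     (\<forall>\<mu> \<nu>. \<theta> \<mu> (\<xi> \<nu>) = (if \<mu> = \<nu> then 1 else 0)) \<and>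
     (\<forall>f \<in> polynomials_over (total_degree_indices p).
        \<exists>c. \<forall>x. f x = (\<Sum>\<mu>\<in>UNIV. c \<mu> * \<theta> \<mu> x))"

definition reference_map :: "('d::finite, 'e, 'j) mesh \<Rightarrow> 'e \<Rightarrow> real^'d \<Rightarrow> real^'d" where
  "reference_map M i x =
     vert M i None + (\<Sum>k\<in>UNIV. (x $ k) *\<^sub>R (vert M i (Some k) - vert M i None))"

text \<open>The polynomial basis functions are taken as functions on the whole space.\<close>

definition primal_basis ::
    "('d::finite, 'e, 'j) mesh \<Rightarrow> nat \<Rightarrow> ('e \<Rightarrow> 'f::finite \<Rightarrow> real^'d \<Rightarrow> real) \<Rightarrow> bool" where
  "primal_basis M p \<phi> \<longleftrightarrow>
     (\<exists>\<xi> \<theta>. nodal_basis p \<xi> \<theta> \<and> (\<forall>i \<mu> x. \<phi> i \<mu> (reference_map M i x) = \<theta> \<mu> x)) \<and>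
     (\<forall>i. lin_indep_on (element M i) (\<phi> i) \<and> (\<forall>\<mu>. smooth_on_set (element M i) (\<phi> i \<mu>)))"

definition lagrange :: "(nat \<Rightarrow> real) \<Rightarrow> nat \<Rightarrow> nat \<Rightarrow> real \<Rightarrow> real" where
  "lagrange \<eta> p a t = (\<Prod>b\<in>{..p} - {a}. (t - \<eta> b) / (\<eta> a - \<eta> b))"

definition tensor_lagrange :: "(nat \<Rightarrow> real) \<Rightarrow> nat \<Rightarrow> ('d::finite \<Rightarrow> nat) \<Rightarrow> real^'d \<Rightarrow> real" where
  "tensor_lagrange \<eta> p a x = (\<Prod>k\<in>UNIV. lagrange \<eta> p (a k) (x $ k))"

definition unit_cube :: "(real^'d::finite) set" where
  "unit_cube = {x. \<forall>k. 0 \<le> x $ k \<and> x $ k \<le> 1}"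

text \<open>
  In dimension two, the map \<open>G\<close> is affine in each coordinate separately, i.e. bilinear in the sense of
  finite elements. Requiring it to be a bijection from the square onto the quadrilateral leaves the
  order in which the corners are matched open.
\<close>

definition mapped_tensor_basis ::
    "nat \<Rightarrow> (nat \<Rightarrow> real) \<Rightarrow> ('k \<Rightarrow> 'd \<Rightarrow> nat) \<Rightarrow>
     (real^'d::finite) set \<Rightarrow> ('k::finite \<Rightarrow> real^'d \<Rightarrow> real) \<Rightarrow> bool" where
  "mapped_tensor_basis p \<eta> e R \<psi> \<longleftrightarrow>
     (\<exists>G. (\<forall>k. (\<lambda>x. G x $ k) \<in> polynomials_over (tensor_indices 1)) \<and>
          bij_betw G unit_cube R \<and>
          (\<forall>\<kappa>. \<forall>x\<in>unit_cube. \<psi> \<kappa> (G x) = tensor_lagrange \<eta> p (e \<kappa>) x))"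

text \<open>
  In dimension three, both the expansion point \<open>z\<close> and the positive scaling factors \<open>w\<close> (such as
  \<open>1 / (a! h\<^sup>a)\<close> for a local length \<open>h\<close>) are arbitrary.
\<close>

definition taylor_basis ::
    "('k \<Rightarrow> 'd \<Rightarrow> nat) \<Rightarrow> (real^'d::finite) set \<Rightarrow> ('k::finite \<Rightarrow> real^'d \<Rightarrow> real) \<Rightarrow> bool" where
  "taylor_basis e R \<psi> \<longleftrightarrow>
     (\<exists>z w. (\<forall>\<kappa>. w \<kappa> > 0) \<and> (\<forall>\<kappa>. \<forall>x\<in>R. \<psi> \<kappa> x = w \<kappa> * monomial_at z (e \<kappa>) x))"

definition dual_basis ::
    "('d::finite, 'e, 'j) mesh \<Rightarrow> nat \<Rightarrow> ('j \<Rightarrow> 'k::finite \<Rightarrow> real^'d \<Rightarrow> real) \<Rightarrow> bool" where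
  "dual_basis M p \<psi> \<longleftrightarrow>
     (CARD('d) = 2 \<longrightarrow>
        (\<exists>\<eta> e. inj_on \<eta> {..p} \<and> \<eta> ` {..p} \<subseteq> {0..1} \<and> bij_betw e UNIV (tensor_indices p) \<and>
               (\<forall>j. mapped_tensor_basis p \<eta> e (dual_element M j) (\<psi> j)))) \<and>
     (CARD('d) = 3 \<longrightarrow>
        (\<exists>e. bij_betw e UNIV (total_degree_indices p) \<and>
             (\<forall>j. taylor_basis e (dual_element M j) (\<psi> j)))) \<and>
     (\<forall>j. lin_indep_on (dual_element M j) (\<psi> j) \<and>
          (\<forall>\<kappa>. smooth_on_set (dual_element M j) (\<psi> j \<kappa>)))"


subsection \<open>Stiffness tensor\<close>

definition stiffness_tensor :: "('d::finite \<Rightarrow> 'd \<Rightarrow> 'd \<Rightarrow> 'd \<Rightarrow> real) \<Rightarrow> bool" where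
  "stiffness_tensor E \<longleftrightarrow>
     (\<forall>k l m n. E k l m n = E l k m n \<and> E k l m n = E k l n m \<and> E k l m n = E m n k l) \<and>
     (\<forall>\<epsilon> :: real^'d^'d. transpose \<epsilon> = \<epsilon> \<and> \<epsilon> \<noteq> 0 \<longrightarrow>
        (\<Sum>k\<in>UNIV. \<Sum>l\<in>UNIV. \<Sum>m\<in>UNIV. \<Sum>n\<in>UNIV. E k l m n * \<epsilon> $ k $ l * \<epsilon> $ m $ n) > 0)"


subsection \<open>Matrices of the scheme\<close>

definition mass_primal ::
    "('d::finite, 'e, 'j) mesh \<Rightarrow> ('e \<Rightarrow> 'f::finite \<Rightarrow> real^'d \<Rightarrow> real) \<Rightarrow> 'e \<Rightarrow> real^'f^'f" where
  "mass_primal M \<phi> i = (\<chi> \<mu> \<nu>. LINT x : element M i | lborel. \<phi> i \<mu> x * \<phi> i \<nu> x)"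

definition mass_dual ::
    "('d::finite, 'e, 'j) mesh \<Rightarrow> ('j \<Rightarrow> 'k::finite \<Rightarrow> real^'d \<Rightarrow> real) \<Rightarrow> 'j \<Rightarrow> real^'k^'k" where
  "mass_dual M \<psi> j = (\<chi> \<kappa> \<alpha>. LINT x : dual_element M j | lborel. \<psi> j \<kappa> x * \<psi> j \<alpha> x)"

text \<open>The basis functions of \<open>T\<^sub>i\<close> transported to the copy of \<open>T\<^sub>i\<close> adjacent to \<open>\<Gamma>\<^sub>j\<close>.\<close>

definition primal_at ::
    "('d::finite, 'e, 'j) mesh \<Rightarrow> ('e \<Rightarrow> 'f \<Rightarrow> real^'d \<Rightarrow> real) \<Rightarrow> 'e \<Rightarrow> 'j \<Rightarrow>
     'f \<Rightarrow> real^'d \<Rightarrow> real" where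
  "primal_at M \<phi> i j \<mu> x = \<phi> i \<mu> (x + offset M i j)"

text \<open>
  Space-time basis functions of degree zero in time do not depend on \<open>t\<close>, hence neither do the
  integrands of the time integrals over \<open>{t0..t1}\<close>.
\<close>

definition D_matrix ::
    "('d::finite, 'e, 'j) mesh \<Rightarrow> ('e \<Rightarrow> 'f::finite \<Rightarrow> real^'d \<Rightarrow> real) \<Rightarrow>
     ('j \<Rightarrow> 'k::finite \<Rightarrow> real^'d \<Rightarrow> real) \<Rightarrow> real \<Rightarrow> real \<Rightarrow> 'e \<Rightarrow> 'j \<Rightarrow> 'd \<Rightarrow> real^'k^'f" where
  "D_matrix M \<phi> \<psi> t0 t1 i j m = (\<chi> \<mu> \<kappa>.
     LINT t : {t0..t1} | lborel.
       surface_integral (face M j)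
         (\<lambda>x. primal_at M \<phi> i j \<mu> x * \<psi> j \<kappa> x * outward_normal M i j $ m) -
       (LINT x : subelement M i j | lborel. partial_deriv m (primal_at M \<phi> i j \<mu>) x * \<psi> j \<kappa> x))"

definition Q_matrix ::
    "('d::finite, 'e, 'j) mesh \<Rightarrow> ('e \<Rightarrow> 'f::finite \<Rightarrow> real^'d \<Rightarrow> real) \<Rightarrow>
     ('j \<Rightarrow> 'k::finite \<Rightarrow> real^'d \<Rightarrow> real) \<Rightarrow> real \<Rightarrow> real \<Rightarrow> 'e \<Rightarrow> 'j \<Rightarrow> 'd \<Rightarrow> real^'f^'k" where
  "Q_matrix M \<phi> \<psi> t0 t1 i j m = (\<chi> \<kappa> \<mu>.
     LINT t : {t0..t1} | lborel.
       (LINT x : subelement M i j | lborel. \<psi> j \<kappa> x * partial_deriv m (primal_at M \<phi> i j \<mu>) x) -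
       surface_integral (face M j)
         (\<lambda>x. \<psi> j \<kappa> x * primal_at M \<phi> i j \<mu> x * side_sign M i j * face_normal M j $ m))"

definition velocity_operator ::
    "('d::finite, 'e::finite, 'j::finite) mesh \<Rightarrow> ('e \<Rightarrow> 'f::finite \<Rightarrow> real^'d \<Rightarrow> real) \<Rightarrow>
     ('j \<Rightarrow> 'k::finite \<Rightarrow> real^'d \<Rightarrow> real) \<Rightarrow> real \<Rightarrow> ('d \<Rightarrow> 'd \<Rightarrow> 'd \<Rightarrow> 'd \<Rightarrow> real) \<Rightarrow>
     real \<Rightarrow> real \<Rightarrow> real^('e \<times> 'f \<times> 'd) \<Rightarrow> real^('e \<times> 'f \<times> 'd)" where
  "velocity_operator M \<phi> \<psi> \<rho> E t0 t1 v = (\<chi> r. case r of (i, \<mu>, k) \<Rightarrow>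
     \<rho> * (\<Sum>\<nu>\<in>UNIV. mass_primal M \<phi> i $ \<mu> $ \<nu> * v $ (i, \<nu>, k)) -
     1/4 * (\<Sum>j\<in>faces_of M i. \<Sum>q\<in>UNIV. \<Sum>\<kappa>\<in>UNIV. \<Sum>\<alpha>\<in>UNIV. \<Sum>l\<in>UNIV. \<Sum>m\<in>UNIV.
       D_matrix M \<phi> \<psi> t0 t1 i j q $ \<mu> $ \<kappa> * matrix_inv (mass_dual M \<psi> j) $ \<kappa> $ \<alpha> * E k q l m *
       ((\<Sum>\<nu>\<in>UNIV. Q_matrix M \<phi> \<psi> t0 t1 i j m $ \<alpha> $ \<nu> * v $ (i, \<nu>, l)) +
        (\<Sum>\<nu>\<in>UNIV. Q_matrix M \<phi> \<psi> t0 t1 (neighbour M i j) j m $ \<alpha> $ \<nu> *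
                    v $ (neighbour M i j, \<nu>, l)))))"

definition velocity_matrix ::
    "('d::finite, 'e::finite, 'j::finite) mesh \<Rightarrow> ('e \<Rightarrow> 'f::finite \<Rightarrow> real^'d \<Rightarrow> real) \<Rightarrow>
     ('j \<Rightarrow> 'k::finite \<Rightarrow> real^'d \<Rightarrow> real) \<Rightarrow> real \<Rightarrow> ('d \<Rightarrow> 'd \<Rightarrow> 'd \<Rightarrow> 'd \<Rightarrow> real) \<Rightarrow>
     real \<Rightarrow> real \<Rightarrow> real^('e \<times> 'f \<times> 'd)^('e \<times> 'f \<times> 'd)" where
  "velocity_matrix M \<phi> \<psi> \<rho> E t0 t1 = matrix (velocity_operator M \<phi> \<psi> \<rho> E t0 t1)"

end

theory Submission imports Defs begin

text \<open>
  The matrix is a mass matrix plus a discrete elastic energy, and the point is to see that the second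
  part is a congruence of a positive semidefinite form.

  The discrete divergence is minus the transpose of the discrete gradient, \<open>D = - Q\<^sup>T\<close>
  (\<open>D_matrix_eq_minus_Q_matrix\<close>): the volume terms differ by a sign, and so do the face terms, because
  the outward normal of \<open>T\<^sub>i\<close> is \<open>s\<^sub>i\<^sub>,\<^sub>j n\<^sub>j\<close> (\<open>outward_normal_eq\<close>). Hence the minus sign in front of
  the stress term turns into a plus, and when the quadratic form is summed over all elements, every
  face \<open>j\<close> receives the contributions of its two elements. They combine with the bracket in the
  definition of the operator to one square: writing \<open>W\<^sub>j\<close> for the sum over both elements of \<open>Q\<close> applied
  to the coefficients of the velocity, the energy is
  \<open>\<rho> \<Sum>\<^sub>i v\<^sub>i \<bullet> M\<^sub>i v\<^sub>i + 1/4 \<Sum>\<^sub>j E\<^sub>k\<^sub>q\<^sub>l\<^sub>m W\<^sub>j\<^sub>,\<^sub>k\<^sub>q \<bullet> M\<^sub>j\<^sup>-\<^sup>1 W\<^sub>j\<^sub>,\<^sub>l\<^sub>m\<close> (\<open>velocity_energy\<close>).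

  Mass matrices are Gram matrices of linearly independent continuous functions, so they are positive
  definite (\<open>gram_matrix_positive\<close>); this makes the first sum strictly positive and the inverses
  meaningful. In the second sum put \<open>W = M\<^sub>j U\<close>. Then \<open>W \<bullet> M\<^sub>j\<^sup>-\<^sup>1 W = U \<bullet> M\<^sub>j U\<close> is the integral over the
  dual element of a product of the functions \<open>u\<close> with coefficients \<open>U\<close>, and the sum over the indices
  becomes the integral of \<open>E\<^sub>k\<^sub>q\<^sub>l\<^sub>m u\<^sub>k\<^sub>q u\<^sub>l\<^sub>m\<close>, which is nonnegative at every point
  (\<open>discrete_energy_nonneg\<close>).
\<close>

section \<open>Gram matrices\<close>

text \<open>
  The integral sees a function only almost everywhere. The points of the interior at which a
  continuous function differs from zero form an open set, and an open null set is empty; the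
  condition \<open>S \<subseteq> closure (interior S)\<close> carries the conclusion to the remaining points, and it holds
  for finite unions of simplices with nonempty interior.
\<close>

lemma zero_if_square_integral_zero:
  fixes f :: "'a::euclidean_space \<Rightarrow> real"
  assumes S: "compact S" "S \<subseteq> closure (interior S)"
    and f: "continuous_on S f"
    and int0: "(LINT x:S|lborel. f x * f x) = 0"
    and x: "x \<in> S"
  shows "f x = 0"
proof -
  let ?g = "\<lambda>x. indicator S x *\<^sub>R (f x * f x)"
  let ?N = "{y \<in> interior S. f y \<noteq> 0}"
  have g: "integrable lborel ?g"
    by (intro borel_integrable_compact continuous_intros f S)
  have "AE y in lborel. ?g y = 0"
    using integral_nonneg_eq_0_iff_AE[OF g] int0
    by (simp add: set_lebesgue_integral_def)
  then have "AE y in lborel. y \<notin> ?N"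
    by eventually_elim (use interior_subset in \<open>auto simp: indicator_def\<close>)
  moreover have "open ?N"
  proof -
    have "continuous_on (interior S) f"
      using f interior_subset continuous_on_subset by blast
    then have "open (interior S \<inter> f -` (- {0}))"
      by (intro continuous_open_preimage) auto
    moreover have "interior S \<inter> f -` (- {0}) = ?N"
      by auto
    ultimately show ?thesis
      by simp
  qed
  ultimately have "?N \<in> null_sets lborel"
    by (subst AE_iff_null_sets) auto
  then have "negligible ?N"
    by (simp add: negligible_iff_null_sets null_sets_completionI)
  with \<open>open ?N\<close> have "?N = {}"
    using open_not_negligible by blast
  moreover have "closure (interior S) \<subseteq> S"
    using S(1) by (simp add: closure_minimal compact_imp_closed interior_subset)
  ultimately show ?thesis
    using continuous_constant_on_closure[of "interior S" f 0 x] f S(2) x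
    by (auto intro: continuous_on_subset)
qed

definition gram_matrix :: "'a::euclidean_space set \<Rightarrow> ('b::finite \<Rightarrow> 'a \<Rightarrow> real) \<Rightarrow> real^'b^'b" where
  "gram_matrix S f = (\<chi> a b. LINT x:S|lborel. f a x * f b x)"

lemma set_integrable_sum:
  fixes g :: "'i \<Rightarrow> 'a \<Rightarrow> real"
  assumes "\<And>i. i \<in> I \<Longrightarrow> set_integrable N S (g i)"
  shows "set_integrable N S (\<lambda>x. \<Sum>i\<in>I. g i x)"
  using assms unfolding set_integrable_def
  by (simp add: sum_distrib_left)

lemma set_integral_sum:
  fixes g :: "'i \<Rightarrow> 'a \<Rightarrow> real"
  assumes "\<And>i. i \<in> I \<Longrightarrow> set_integrable N S (g i)"
  shows "(LINT x:S|N. (\<Sum>i\<in>I. g i x)) = (\<Sum>i\<in>I. LINT x:S|N. g i x)"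
  using assms unfolding set_integrable_def set_lebesgue_integral_def
  by (simp add: sum_distrib_left)

lemma gram_matrix_inner:
  assumes "compact S" "\<And>b. continuous_on S (f b)"
  shows "v \<bullet> (gram_matrix S f *v w) =
    (LINT x:S|lborel. (\<Sum>a\<in>UNIV. v $ a * f a x) * (\<Sum>b\<in>UNIV. w $ b * f b x))"
proof -
  have int: "set_integrable lborel S (\<lambda>x. v $ a * f a x * (w $ b * f b x))" for a b
    unfolding set_integrable_def
    by (intro borel_integrable_compact continuous_intros assms)
  have "(LINT x:S|lborel. (\<Sum>a\<in>UNIV. v $ a * f a x) * (\<Sum>b\<in>UNIV. w $ b * f b x)) =
      (\<Sum>a\<in>UNIV. \<Sum>b\<in>UNIV. LINT x:S|lborel. v $ a * f a x * (w $ b * f b x))"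
    unfolding sum_product by (simp add: set_integral_sum set_integrable_sum int)
  also have "\<dots> = (\<Sum>a\<in>UNIV. \<Sum>b\<in>UNIV. v $ a * (w $ b * (LINT x:S|lborel. f a x * f b x)))"
    by (simp flip: set_integral_mult_right add: mult_ac)
  also have "\<dots> = v \<bullet> (gram_matrix S f *v w)"
    by (simp add: inner_vec_def matrix_vector_mult_def gram_matrix_def sum_distrib_left mult_ac)
  finally show ?thesis ..
qed

text \<open>
  The quadratic form of a Gram matrix is the integral of the square of the function with the given
  coefficients. If it vanished, so would the function on all of \<open>S\<close>, and then its coefficients.
\<close>

lemma gram_matrix_positive:
  assumes "compact S" "S \<subseteq> closure (interior S)" "\<And>b. continuous_on S (f b)"
    and "lin_indep_on S f" "v \<noteq> 0"
  shows "v \<bullet> (gram_matrix S f *v v) > 0"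
proof -
  let ?u = "\<lambda>x. \<Sum>a\<in>UNIV. v $ a * f a x"
  have eq: "v \<bullet> (gram_matrix S f *v v) = (LINT x:S|lborel. ?u x * ?u x)"
    by (rule gram_matrix_inner[OF assms(1,3)])
  have u: "continuous_on S ?u"
    by (intro continuous_intros assms(3))
  have "v \<bullet> (gram_matrix S f *v v) \<noteq> 0"
  proof
    assume "v \<bullet> (gram_matrix S f *v v) = 0"
    then have "(LINT x:S|lborel. ?u x * ?u x) = 0"
      using eq by (rule trans[OF sym, rotated])
    then have "\<forall>x\<in>S. ?u x = 0"
      by (intro ballI zero_if_square_integral_zero[OF assms(1,2) u])
    then have "\<forall>a. v $ a = 0"
      using assms(4) unfolding lin_indep_on_def by blast
    with \<open>v \<noteq> 0\<close> show False
      by (simp add: vec_eq_iff)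
  qed
  moreover have "(LINT x:S|lborel. ?u x * ?u x) \<ge> 0"
    unfolding set_lebesgue_integral_def by (intro integral_nonneg_AE) auto
  ultimately show ?thesis
    using eq by simp
qed

lemma invertible_gram_matrix:
  assumes "compact S" "S \<subseteq> closure (interior S)" "\<And>b. continuous_on S (f b)"
    and "lin_indep_on S f"
  shows "invertible (gram_matrix S f)"
proof -
  have "\<forall>x. gram_matrix S f *v x = 0 \<longrightarrow> x = 0"
    using gram_matrix_positive[OF assms] by (metis inner_zero_right less_irrefl)
  then show ?thesis
    by (simp add: invertible_left_inverse matrix_left_invertible_ker)
qed

lemma smooth_on_set_imp_continuous_on:
  assumes "smooth_on_set S f"
  shows "continuous_on S f"
proof -
  obtain U g where "S \<subseteq> U" "\<forall>x\<in>S. g x = f x" "\<forall>n. C_k_on n U g"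
    using assms unfolding smooth_on_set_def by blast
  then have "continuous_on S g"
    using C_k_on.simps(1) continuous_on_subset by blast
  then show ?thesis
    using \<open>\<forall>x\<in>S. g x = f x\<close> by (simp cong: continuous_on_cong)
qed


section \<open>The elastic energy\<close>

text \<open>
  The contraction with a symmetric array sees only the symmetric part.
\<close>

lemma sum_symmetrized:
  fixes A e :: "'d::finite \<Rightarrow> 'd \<Rightarrow> real"
  assumes "\<And>k l. A k l = A l k"
  shows "(\<Sum>k\<in>UNIV. \<Sum>l\<in>UNIV. A k l * ((e k l + e l k) / 2)) = (\<Sum>k\<in>UNIV. \<Sum>l\<in>UNIV. A k l * e k l)"
proof -
  have "(\<Sum>k\<in>UNIV. \<Sum>l\<in>UNIV. A k l * e l k) = (\<Sum>k\<in>UNIV. \<Sum>l\<in>UNIV. A k l * e k l)"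
    using assms by (subst sum.swap) simp
  then show ?thesis
    by (simp add: distrib_left add_divide_distrib sum.distrib flip: sum_divide_distrib)
qed

text \<open>
  Positivity is given for symmetric strains only, but a discrete velocity gradient need not be
  symmetric. The minor symmetries of \<open>E\<close> allow replacing each factor by its symmetric part.
\<close>

lemma stiffness_tensor_nonneg:
  fixes e :: "'d::finite \<Rightarrow> 'd \<Rightarrow> real"
  assumes "stiffness_tensor E"
  shows "0 \<le> (\<Sum>k\<in>UNIV. \<Sum>l\<in>UNIV. \<Sum>m\<in>UNIV. \<Sum>n\<in>UNIV. E k l m n * e k l * e m n)"
proof -
  have sym: "E k l m n = E l k m n" "E k l m n = E k l n m" for k l m n
    using assms unfolding stiffness_tensor_def by blast+
  define s where "s k l = (e k l + e l k) / 2" for k l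
  define \<epsilon> :: "real^'d^'d" where "\<epsilon> = (\<chi> k l. s k l)"
  have "(\<Sum>k\<in>UNIV. \<Sum>l\<in>UNIV. \<Sum>m\<in>UNIV. \<Sum>n\<in>UNIV. E k l m n * e k l * e m n)
      = (\<Sum>k\<in>UNIV. \<Sum>l\<in>UNIV. (\<Sum>m\<in>UNIV. \<Sum>n\<in>UNIV. E k l m n * e m n) * e k l)"
    by (simp add: sum_distrib_left sum_distrib_right mult_ac)
  also have "\<dots> = (\<Sum>k\<in>UNIV. \<Sum>l\<in>UNIV. (\<Sum>m\<in>UNIV. \<Sum>n\<in>UNIV. E k l m n * e m n) * s k l)"
    unfolding s_def by (rule sum_symmetrized[symmetric])
      (intro sum.cong refl arg_cong2[where f = "(*)"] sym(1))
  also have "\<dots> = (\<Sum>k\<in>UNIV. \<Sum>l\<in>UNIV. (\<Sum>m\<in>UNIV. \<Sum>n\<in>UNIV. E k l m n * s m n) * s k l)"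
    unfolding s_def by (subst sum_symmetrized[OF sym(2)]) (rule refl)
  also have "\<dots> = (\<Sum>k\<in>UNIV. \<Sum>l\<in>UNIV. \<Sum>m\<in>UNIV. \<Sum>n\<in>UNIV. E k l m n * \<epsilon> $ k $ l * \<epsilon> $ m $ n)"
    by (simp add: \<epsilon>_def sum_distrib_left sum_distrib_right mult_ac)
  also have "\<dots> \<ge> 0"
  proof (cases "\<epsilon> = 0")
    case False
    have "transpose \<epsilon> = \<epsilon>"
      by (simp add: \<epsilon>_def s_def transpose_def vec_eq_iff add.commute)
    with False show ?thesis
      using assms unfolding stiffness_tensor_def by (simp add: less_imp_le)
  qed simp
  finally show ?thesis .
qed

text \<open>
  Both the tensor and the inverse mass matrix are positive, but they act on different indices.
  Passing from \<open>W\<close> to \<open>U = G\<^sup>-\<^sup>1 W\<close> turns the matrix product into an integral of products of functions,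
  so that the tensor can be applied under the integral sign, point by point.
\<close>

lemma discrete_energy_nonneg:
  fixes W :: "'d::finite \<Rightarrow> 'd \<Rightarrow> real^'k::finite"
  assumes E: "stiffness_tensor E"
    and S: "compact S" "S \<subseteq> closure (interior S)"
    and f: "\<And>b. continuous_on S (f b)" "lin_indep_on S f"
  shows "0 \<le> (\<Sum>k\<in>UNIV. \<Sum>q\<in>UNIV. \<Sum>l\<in>UNIV. \<Sum>m\<in>UNIV.
    E k q l m * (W k q \<bullet> (matrix_inv (gram_matrix S f) *v W l m)))"
proof -
  let ?G = "gram_matrix S f"
  define U where "U k q = matrix_inv ?G *v W k q" for k q
  define u where "u k q x = (\<Sum>a\<in>UNIV. U k q $ a * f a x)" for k q x
  have inv: "?G ** matrix_inv ?G = mat 1"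
    using invertible_gram_matrix[OF S f] unfolding invertible_def matrix_inv_def
    by (rule someI2_ex) blast
  have W: "W k q = ?G *v U k q" for k q
    by (simp add: U_def matrix_vector_mul_assoc inv)
  have u: "continuous_on S (u k q)" for k q
    unfolding u_def by (intro continuous_intros f)
  have inner: "W k q \<bullet> U l m = (LINT x:S|lborel. u k q x * u l m x)" for k q l m
    unfolding W u_def
    by (subst inner_commute, subst gram_matrix_inner[OF S(1) f(1)]) (simp add: mult.commute)
  have int: "set_integrable lborel S (\<lambda>x. E k q l m * u k q x * u l m x)" for k q l m
    unfolding set_integrable_def by (intro borel_integrable_compact continuous_intros u S)
  have "(\<Sum>k\<in>UNIV. \<Sum>q\<in>UNIV. \<Sum>l\<in>UNIV. \<Sum>m\<in>UNIV. E k q l m * (W k q \<bullet> U l m))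
      = (\<Sum>k\<in>UNIV. \<Sum>q\<in>UNIV. \<Sum>l\<in>UNIV. \<Sum>m\<in>UNIV. LINT x:S|lborel. E k q l m * u k q x * u l m x)"
    by (simp add: inner mult.assoc)
  also have "\<dots> = (LINT x:S|lborel.
      (\<Sum>k\<in>UNIV. \<Sum>q\<in>UNIV. \<Sum>l\<in>UNIV. \<Sum>m\<in>UNIV. E k q l m * u k q x * u l m x))"
    by (simp add: set_integral_sum set_integrable_sum int)
  also have "\<dots> \<ge> 0"
    unfolding set_lebesgue_integral_def
    by (intro integral_nonneg_AE AE_I2 scaleR_nonneg_nonneg stiffness_tensor_nonneg[OF E]) simp
  finally show ?thesis
    unfolding U_def .
qed


section \<open>Geometry of the mesh\<close>

text \<open>
  Everything at a face is expressed in the coordinates of its left element. In these coordinates the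
  left and the right element enjoy the same description, so that the lemmas below need not
  distinguish between the two sides or mention the periodic identification.
\<close>

lemma fvert_eq:
  assumes "periodic_simplicial_mesh \<Omega> M" "j \<in> faces_of M i"
  obtains a where "fvert M j = (\<lambda>b. vert M i b - offset M i j) ` (- {a})"
proof (cases "i = lft M j")
  case True
  have "fvert M j \<in> facet_vertices M (lft M j)"
    using assms(1) unfolding periodic_simplicial_mesh_def by blast
  then show ?thesis
    using that True unfolding facet_vertices_def offset_def by auto
next
  case False
  then have i: "i = rgt M j"
    using assms(2) by (simp add: faces_of_def)
  have "(+) (period M j) ` fvert M j \<in> facet_vertices M (rgt M j)"
    using assms(1) unfolding periodic_simplicial_mesh_def by blast
  then obtain a where a: "(+) (period M j) ` fvert M j = vert M i ` (- {a})"
    unfolding facet_vertices_def i by auto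
  have "fvert M j = (\<lambda>x. x - period M j) ` (+) (period M j) ` fvert M j"
    by (simp add: image_image)
  then show ?thesis
    using that[of a] False unfolding a offset_def by (simp add: image_image)
qed

lemma element_at_eq:
  "element_at M i j = convex hull range (\<lambda>b. vert M i b - offset M i j)"
proof -
  have eq: "(\<lambda>x. x - offset M i j) = (+) (- offset M i j)"
    by auto
  show ?thesis
    unfolding element_at_def element_def eq convex_hull_translation[symmetric]
    by (simp add: image_image)
qed

lemma interior_element_nonempty:
  fixes M :: "('d::finite, 'e::finite, 'j::finite) mesh"
  assumes "periodic_simplicial_mesh \<Omega> M"
  shows "interior (element M i) \<noteq> {}"
proof -
  have inj: "inj (vert M i)" and indep: "\<not> affine_dependent (range (vert M i))"
    using assms by (simp_all add: periodic_simplicial_mesh_def)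
  have "card (range (vert M i)) = Suc (DIM(real^'d))"
    by (simp add: card_image[OF inj] card_UNIV_option)
  then show ?thesis
    using interior_convex_hull_eq_empty[of "range (vert M i)"] indep
    unfolding element_def by simp
qed

lemma interior_element_at_nonempty:
  fixes M :: "('d::finite, 'e::finite, 'j::finite) mesh"
  assumes "periodic_simplicial_mesh \<Omega> M"
  shows "interior (element_at M i j) \<noteq> {}"
proof -
  have eq: "(\<lambda>x. x - offset M i j) = (+) (- offset M i j)"
    by auto
  show ?thesis
    unfolding element_at_def eq interior_translation
    using interior_element_nonempty[OF assms] by simp
qed

lemma compact_element: "compact (element M i)"
  unfolding element_def by (intro finite_imp_compact_convex_hull) simp

lemma element_subset_closure_interior:
  assumes "periodic_simplicial_mesh \<Omega> M"
  shows "element M i \<subseteq> closure (interior (element M i))"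
proof -
  have "convex (element M i)"
    unfolding element_def by simp
  from convex_closure_interior[OF this interior_element_nonempty[OF assms]]
  show ?thesis
    by (simp add: closure_subset)
qed

lemma element_at_not_in_hyperplane:
  assumes mesh: "periodic_simplicial_mesh \<Omega> M"
    and sub: "element_at M i j \<subseteq> {x. w \<bullet> x = c}"
  shows "w = 0"
proof (rule ccontr)
  assume "w \<noteq> 0"
  then have "interior {x. w \<bullet> x = c} = {}"
    by simp
  then show False
    using interior_mono[OF sub] interior_element_at_nonempty[OF mesh] by blast
qed

text \<open>
  A hyperplane containing the subelement contains the face and the barycenter. The barycenter has
  positive weight at the vertex opposite to the face, so this vertex, and with it the whole element,
  would lie in the hyperplane as well.
\<close>

lemma interior_subelement_nonempty:
  assumes mesh: "periodic_simplicial_mesh \<Omega> M" and j: "j \<in> faces_of M i"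
  shows "interior (subelement M i j) \<noteq> {}"
proof
  let ?v = "\<lambda>b. vert M i b - offset M i j"
  let ?n = "real (CARD('a) + 1)"
  assume "interior (subelement M i j) = {}"
  moreover have "convex (subelement M i j)"
    unfolding subelement_def by simp
  ultimately obtain w c where w: "w \<noteq> 0" "subelement M i j \<subseteq> {x. w \<bullet> x = c}"
    using empty_interior_subset_hyperplane by blast
  obtain a where F: "fvert M j = ?v ` (- {a})"
    by (rule fvert_eq[OF mesh j])
  have "insert (barycenter M i - offset M i j) (fvert M j) \<subseteq> {x. w \<bullet> x = c}" (is "?sub")
    using w(2) unfolding subelement_def by (rule order_trans[OF hull_subset])
  then have on_bary: "w \<bullet> (barycenter M i - offset M i j) = c"
    by simp
  have on_face: "w \<bullet> ?v b = c" if "b \<noteq> a" for b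
    using \<open>?sub\<close> that unfolding F by auto
  have "?n *\<^sub>R (barycenter M i - offset M i j) = (\<Sum>b\<in>UNIV. ?v b)"
    by (simp add: barycenter_def scaleR_right_diff_distrib sum_subtractf card_UNIV_option
        sum_constant_scaleR del: sum_constant)
  then have "?n * c = (\<Sum>b\<in>UNIV. w \<bullet> ?v b)"
    using on_bary by (metis inner_scaleR_right inner_sum_right)
  also have "\<dots> = w \<bullet> ?v a + (\<Sum>b\<in>UNIV - {a}. w \<bullet> ?v b)"
    by (simp add: sum.remove[of UNIV a])
  also have "(\<Sum>b\<in>UNIV - {a}. w \<bullet> ?v b) = (\<Sum>b\<in>UNIV - {a}. c)"
    by (rule sum.cong) (auto intro: on_face)
  also have "\<dots> = real (CARD('a)) * c"
    by (simp add: card_Diff_singleton card_UNIV_option)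
  finally have "w \<bullet> ?v a = c"
    by (simp add: algebra_simps)
  then have "w \<bullet> ?v b = c" for b
    using on_face by (cases "b = a") auto
  then have "range ?v \<subseteq> {x. w \<bullet> x = c}"
    by auto
  then have "element_at M i j \<subseteq> {x. w \<bullet> x = c}"
    unfolding element_at_eq by (intro hull_minimal convex_hyperplane)
  with w(1) show False
    using element_at_not_in_hyperplane[OF mesh] by blast
qed

lemma lft_rgt_faces_of: "j \<in> faces_of M (lft M j)" "j \<in> faces_of M (rgt M j)"
  by (simp_all add: faces_of_def)

lemma compact_subelement:
  fixes M :: "('d::finite, 'e::finite, 'j::finite) mesh"
  assumes "periodic_simplicial_mesh \<Omega> M" "j \<in> faces_of M i"
  shows "compact (subelement M i j)"
proof -
  obtain a where "fvert M j = (\<lambda>b. vert M i b - offset M i j) ` (- {a})"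
    by (rule fvert_eq[OF assms])
  then show ?thesis
    unfolding subelement_def by (intro finite_imp_compact_convex_hull) simp
qed

lemma compact_dual_element:
  assumes "periodic_simplicial_mesh \<Omega> M"
  shows "compact (dual_element M j)"
  unfolding dual_element_def by (intro compact_Un compact_subelement[OF assms] lft_rgt_faces_of)

lemma dual_element_subset_closure_interior:
  assumes "periodic_simplicial_mesh \<Omega> M"
  shows "dual_element M j \<subseteq> closure (interior (dual_element M j))"
proof -
  have "subelement M i j \<subseteq> closure (interior (dual_element M j))"
    if "j \<in> faces_of M i" "subelement M i j \<subseteq> dual_element M j" for i
  proof -
    have "convex (subelement M i j)"
      unfolding subelement_def by simp
    from convex_closure_interior[OF this interior_subelement_nonempty[OF assms that(1)]]
    have "subelement M i j \<subseteq> closure (interior (subelement M i j))"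
      by (simp add: closure_subset)
    also have "\<dots> \<subseteq> closure (interior (dual_element M j))"
      by (intro closure_mono interior_mono that)
    finally show ?thesis .
  qed
  from this[OF lft_rgt_faces_of(1)] this[OF lft_rgt_faces_of(2)] show ?thesis
    by (auto simp: dual_element_def)
qed

definition outward_unit_normal :: "(real^'d::finite) set \<Rightarrow> (real^'d) set \<Rightarrow> real^'d \<Rightarrow> bool" where
  "outward_unit_normal F T n \<longleftrightarrow> unit_normal_to F n \<and> (\<forall>y\<in>F. \<forall>x\<in>T. n \<bullet> (x - y) \<le> 0)"

lemma face_subset_element_at:
  assumes "periodic_simplicial_mesh \<Omega> M" "j \<in> faces_of M i"
  shows "face M j \<subseteq> element_at M i j"
proof -
  obtain a where "fvert M j = (\<lambda>b. vert M i b - offset M i j) ` (- {a})"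
    by (rule fvert_eq[OF assms])
  then show ?thesis
    unfolding face_def element_at_eq by (intro hull_mono) auto
qed

lemma face_nonempty:
  fixes M :: "('d::finite, 'e::finite, 'j::finite) mesh"
  assumes "periodic_simplicial_mesh \<Omega> M"
  shows "face M j \<noteq> {}"
proof -
  obtain a where a: "fvert M j = (\<lambda>b. vert M (lft M j) b - offset M (lft M j) j) ` (- {a})"
    by (rule fvert_eq[OF assms lft_rgt_faces_of(1)])
  have "- {a} \<noteq> {}"
    by (cases a) (metis ComplI empty_iff option.distinct(1) singletonD)+
  then show ?thesis
    unfolding face_def a by simp
qed

text \<open>
  Together with one vector pointing from the face to the opposite vertex, the directions of the face
  span the space. Hence a normal of the face is determined by its component along this vector, whose
  sign is fixed by the orientation and whose size is fixed by the norm.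
\<close>

lemma outward_unit_normal_unique:
  fixes M :: "('d::finite, 'e::finite, 'j::finite) mesh"
  assumes mesh: "periodic_simplicial_mesh \<Omega> M" and j: "j \<in> faces_of M i"
    and n: "outward_unit_normal (face M j) (element_at M i j) n"
    and n': "outward_unit_normal (face M j) (element_at M i j) n'"
  shows "n' = n"
proof -
  let ?v = "\<lambda>b. vert M i b - offset M i j"
  obtain a where F: "fvert M j = ?v ` (- {a})"
    by (rule fvert_eq[OF mesh j])
  obtain y where y: "y \<in> face M j"
    using face_nonempty[OF mesh] by blast
  \<comment> \<open>The spanning property in dual form: only zero is orthogonal to the face and to the apex.\<close>
  have zero: "w = 0" if face: "\<And>x. x \<in> face M j \<Longrightarrow> w \<bullet> (x - y) = 0"
    and apex: "w \<bullet> (?v a - y) = 0" for w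
  proof -
    have "w \<bullet> ?v b = w \<bullet> y" for b
    proof (cases "b = a")
      case False
      then have "?v b \<in> face M j"
        unfolding face_def F by (intro hull_inc) auto
      from face[OF this] show ?thesis
        by (simp add: inner_diff_right)
    qed (use apex in \<open>simp add: inner_diff_right\<close>)
    then have "element_at M i j \<subseteq> {x. w \<bullet> x = w \<bullet> y}"
      unfolding element_at_eq by (intro hull_minimal convex_hyperplane) auto
    then show ?thesis
      by (rule element_at_not_in_hyperplane[OF mesh])
  qed
  have apex_in: "?v a \<in> element_at M i j"
    unfolding element_at_eq by (intro hull_inc) auto
  let ?h = "n \<bullet> (?v a - y)" and ?h' = "n' \<bullet> (?v a - y)"
  have unit: "norm n = 1" "norm n' = 1"
    and orth: "\<And>x. x \<in> face M j \<Longrightarrow> n \<bullet> (x - y) = 0 \<and> n' \<bullet> (x - y) = 0"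
    using n n' y unfolding outward_unit_normal_def unit_normal_to_def by auto
  have "?h \<le> 0" "?h' \<le> 0"
    using n n' y apex_in unfolding outward_unit_normal_def by auto
  moreover have "?h \<noteq> 0"
    using zero[of n] orth unit(1) by auto
  ultimately have c: "?h' / ?h \<ge> 0"
    by (simp add: divide_nonpos_nonpos)
  \<comment> \<open>The factor is chosen to cancel the component along the direction to the apex.\<close>
  have "n' - (?h' / ?h) *\<^sub>R n = 0"
    using orth \<open>?h \<noteq> 0\<close> by (intro zero) (simp_all add: inner_diff_left)
  then have n'_eq: "n' = (?h' / ?h) *\<^sub>R n"
    by simp
  then have "?h' / ?h = 1"
    using unit c by (metis abs_of_nonneg mult.right_neutral norm_scaleR)
  then show ?thesis
    using n'_eq by simp
qed

text \<open>
  The two elements at a face are convex with disjoint interiors, so a hyperplane separates them. It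
  contains their intersection, in particular the face; hence its normal is a normal of the face, and
  separation means that it is outward for one element and inward for the other.
\<close>

lemma ex_common_face_normal:
  assumes mesh: "periodic_simplicial_mesh \<Omega> M"
  obtains n where "outward_unit_normal (face M j) (element_at M (lft M j) j) n"
    and "outward_unit_normal (face M j) (element_at M (rgt M j) j) (- n)"
proof -
  let ?L = "element_at M (lft M j) j" and ?R = "element_at M (rgt M j) j"
  have conv: "convex ?L" "convex ?R"
    by (simp_all add: element_at_eq)
  have ne: "interior ?L \<noteq> {}" "interior ?R \<noteq> {}"
    by (rule interior_element_at_nonempty[OF mesh])+
  have "interior ?L \<inter> interior ?R = {}"
    using mesh unfolding periodic_simplicial_mesh_def by blast
  then obtain w c where w: "w \<noteq> 0"
    and L: "\<forall>x\<in>interior ?L. w \<bullet> x \<le> c" and R: "\<forall>x\<in>interior ?R. w \<bullet> x \<ge> c"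
    using separating_hyperplane_sets[of "interior ?L" "interior ?R"] conv ne
    by (auto simp: convex_interior)
  have "closure (interior ?L) \<subseteq> {x. w \<bullet> x \<le> c}"
    using L by (intro closure_minimal closed_halfspace_le) auto
  then have L: "w \<bullet> x \<le> c" if "x \<in> ?L" for x
    using that closure_subset[of ?L] convex_closure_interior[OF conv(1) ne(1)] by auto
  have "closure (interior ?R) \<subseteq> {x. w \<bullet> x \<ge> c}"
    using R by (intro closure_minimal closed_halfspace_ge) auto
  then have R: "w \<bullet> x \<ge> c" if "x \<in> ?R" for x
    using that closure_subset[of ?R] convex_closure_interior[OF conv(2) ne(2)] by auto
  have F: "w \<bullet> y = c" if "y \<in> face M j" for y
    using that L R face_subset_element_at[OF mesh lft_rgt_faces_of(1), of j]
      face_subset_element_at[OF mesh lft_rgt_faces_of(2), of j] by (meson antisym subsetD)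
  define n where "n = w /\<^sub>R norm w"
  have n: "n \<bullet> (x - y) = (w \<bullet> x - w \<bullet> y) / norm w" for x y
    by (simp add: n_def inner_diff_right divide_inverse algebra_simps)
  have unit: "unit_normal_to (face M j) n"
    unfolding unit_normal_to_def using w F by (simp add: n) (simp add: n_def)
  show ?thesis
  proof (rule that)
    show "outward_unit_normal (face M j) ?L n"
      unfolding outward_unit_normal_def using unit L F
      by (simp add: n divide_le_0_iff)
    show "outward_unit_normal (face M j) ?R (- n)"
      unfolding outward_unit_normal_def using unit R F
      by (simp add: n unit_normal_to_def)
  qed
qed

text \<open>
  The common normal satisfies the descriptions of both normals, which determine it uniquely. The
  numbering of the elements is injective, so the denominator of the sign is not zero and the
  quotient is \<open>1\<close> on the left and \<open>-1\<close> on the right.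
\<close>

lemma outward_normal_eq:
  assumes mesh: "periodic_simplicial_mesh \<Omega> M" and j: "j \<in> faces_of M i"
  shows "outward_normal M i j = side_sign M i j *\<^sub>R face_normal M j"
proof -
  obtain n where L: "outward_unit_normal (face M j) (element_at M (lft M j) j) n"
    and R: "outward_unit_normal (face M j) (element_at M (rgt M j) j) (- n)"
    by (rule ex_common_face_normal[OF mesh])
  have out: "outward_normal M i j = n'"
    if "outward_unit_normal (face M j) (element_at M i j) n'" for n'
    unfolding outward_normal_def outward_unit_normal_def[symmetric]
    using that outward_unit_normal_unique[OF mesh j] by blast
  have "face_normal M j = n"
    unfolding face_normal_def
  proof (rule the_equality)
    show "unit_normal_to (face M j) n \<and>
      (\<forall>y\<in>face M j. (\<forall>x\<in>element_at M (lft M j) j. n \<bullet> (x - y) \<le> 0) \<and>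
                     (\<forall>x\<in>element_at M (rgt M j) j. n \<bullet> (x - y) \<ge> 0))"
      using L R unfolding outward_unit_normal_def by auto
  next
    fix n' assume "unit_normal_to (face M j) n' \<and>
      (\<forall>y\<in>face M j. (\<forall>x\<in>element_at M (lft M j) j. n' \<bullet> (x - y) \<le> 0) \<and>
                     (\<forall>x\<in>element_at M (rgt M j) j. n' \<bullet> (x - y) \<ge> 0))"
    then have "outward_unit_normal (face M j) (element_at M (lft M j) j) n'"
      unfolding outward_unit_normal_def by blast
    then show "n' = n"
      using outward_unit_normal_unique[OF mesh lft_rgt_faces_of(1) L] by blast
  qed
  moreover have "elem_no M (lft M j) \<noteq> elem_no M (rgt M j)"
    using mesh unfolding periodic_simplicial_mesh_def bij_betw_def by (metis injD)
  then have "side_sign M (lft M j) j = 1" "side_sign M (rgt M j) j = - 1"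
    by (simp_all add: side_sign_def divide_simps)
  ultimately show ?thesis
    using j out L R by (auto simp: faces_of_def)
qed


section \<open>The energy identity\<close>

text \<open>
  The duality behind the whole argument. With the two normals identified, the face integrands and the
  volume integrands of the two matrices agree, and only the signs in front of them are opposite.
\<close>

lemma D_matrix_eq_minus_Q_matrix:
  assumes "periodic_simplicial_mesh \<Omega> M" "j \<in> faces_of M i"
  shows "D_matrix M \<phi> \<psi> t0 t1 i j m $ \<mu> $ \<kappa> = - Q_matrix M \<phi> \<psi> t0 t1 i j m $ \<kappa> $ \<mu>"
proof -
  let ?a = "surface_integral (face M j)
    (\<lambda>x. \<psi> j \<kappa> x * primal_at M \<phi> i j \<mu> x * side_sign M i j * face_normal M j $ m)"
  let ?b = "LINT x:subelement M i j|lborel. \<psi> j \<kappa> x * partial_deriv m (primal_at M \<phi> i j \<mu>) x"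
  have uminus: "(LINT t:{t0..t1}|lborel. - c) = - (LINT t:{t0..t1}|lborel. c)" for c :: real
    by (simp add: set_lebesgue_integral_def)
  have "D_matrix M \<phi> \<psi> t0 t1 i j m $ \<mu> $ \<kappa> = (LINT t:{t0..t1}|lborel. ?a - ?b)"
    by (simp add: D_matrix_def outward_normal_eq[OF assms] mult_ac)
  also have "\<dots> = - (LINT t:{t0..t1}|lborel. ?b - ?a)"
    using uminus[of "?b - ?a"] by simp
  also have "\<dots> = - Q_matrix M \<phi> \<psi> t0 t1 i j m $ \<kappa> $ \<mu>"
    by (simp add: Q_matrix_def)
  finally show ?thesis .
qed

definition component_dofs :: "real^('e::finite \<times> 'f::finite \<times> 'd::finite) \<Rightarrow> 'e \<Rightarrow> 'd \<Rightarrow> real^'f" where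
  "component_dofs v i k = (\<chi> \<mu>. v $ (i, \<mu>, k))"

text \<open>
  The moments, against the dual basis, of the contribution of \<open>T\<^sub>i\<close> to the weak derivative \<open>\<partial>\<^sub>m v\<^sub>l\<close>,
  integrated in time. The sum of the contributions of the two sides is the weak derivative on the
  dual element, including the jump of the velocity across the face.
\<close>

definition element_gradient where
  "element_gradient M \<phi> \<psi> t0 t1 v i j l m = Q_matrix M \<phi> \<psi> t0 t1 i j m *v component_dofs v i l"

definition face_gradient where
  "face_gradient M \<phi> \<psi> t0 t1 v j l m =
    element_gradient M \<phi> \<psi> t0 t1 v (lft M j) j l m + element_gradient M \<phi> \<psi> t0 t1 v (rgt M j) j l m"

lemma linear_velocity_operator: "linear (velocity_operator M \<phi> \<psi> \<rho> E t0 t1)"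
  unfolding velocity_operator_def
  by (rule linearI)
    (simp_all add: vec_eq_iff algebra_simps sum.distrib sum_distrib_left split: prod.splits)

lemma sum_UNIV_triple:
  fixes g :: "'a::finite \<times> 'b::finite \<times> 'c::finite \<Rightarrow> real"
  shows "(\<Sum>r\<in>UNIV. g r) = (\<Sum>i\<in>UNIV. \<Sum>k\<in>UNIV. \<Sum>\<mu>\<in>UNIV. g (i, \<mu>, k))"
proof -
  have "(\<Sum>r\<in>UNIV. g r) = (\<Sum>i\<in>UNIV. \<Sum>\<mu>\<in>UNIV. \<Sum>k\<in>UNIV. g (i, \<mu>, k))"
    by (simp add: sum.cartesian_product UNIV_Times_UNIV[symmetric] del: UNIV_Times_UNIV)
  then show ?thesis
    by (simp add: sum.swap[of _ "UNIV::'b set" "UNIV::'c set"])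
qed

lemma sum_faces_of:
  fixes M :: "('d::finite, 'e::finite, 'j::finite) mesh" and g :: "'e \<Rightarrow> 'j \<Rightarrow> real"
  assumes "periodic_simplicial_mesh \<Omega> M"
  shows "(\<Sum>i\<in>UNIV. \<Sum>j\<in>faces_of M i. g i j) = (\<Sum>j\<in>UNIV. g (lft M j) j + g (rgt M j) j)"
proof -
  have "(\<Sum>i\<in>UNIV. \<Sum>j\<in>faces_of M i. g i j) = (\<Sum>j\<in>UNIV. \<Sum>i | j \<in> faces_of M i. g i j)"
    using sum.swap_restrict[of UNIV UNIV g "\<lambda>i j. j \<in> faces_of M i"] by simp
  also have "\<dots> = (\<Sum>j\<in>UNIV. \<Sum>i\<in>{lft M j, rgt M j}. g i j)"
    by (intro sum.cong refl) (auto simp: faces_of_def)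
  also have "\<dots> = (\<Sum>j\<in>UNIV. g (lft M j) j + g (rgt M j) j)"
    using assms unfolding periodic_simplicial_mesh_def by (intro sum.cong refl) simp
  finally show ?thesis .
qed

lemma sum_swap_pairs:
  "(\<Sum>a\<in>A. \<Sum>b\<in>B. \<Sum>c\<in>C. \<Sum>d\<in>D. f c d a b) = (\<Sum>c\<in>C. \<Sum>d\<in>D. \<Sum>a\<in>A. \<Sum>b\<in>B. f c d a b)"
proof -
  have "(\<Sum>a\<in>A. \<Sum>b\<in>B. \<Sum>c\<in>C. \<Sum>d\<in>D. f c d a b) = (\<Sum>c\<in>C. \<Sum>a\<in>A. \<Sum>b\<in>B. \<Sum>d\<in>D. f c d a b)"
    by (simp add: sum.swap[of _ B C] sum.swap[of _ A C])
  also have "\<dots> = (\<Sum>c\<in>C. \<Sum>d\<in>D. \<Sum>a\<in>A. \<Sum>b\<in>B. f c d a b)"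
    by (simp add: sum.swap[of _ B D] sum.swap[of _ A D])
  finally show ?thesis .
qed

text \<open>
  The stress term carries \<open>D\<close>, and by the duality this is \<open>- Q\<^sup>T\<close>, so that its sign changes. The bracket
  in the operator is the gradient on the dual element irrespective of which of the two sides \<open>i\<close> is;
  therefore the terms of the two sides will add up to a quadratic form.
\<close>

lemma velocity_operator_component:
  assumes mesh: "periodic_simplicial_mesh \<Omega> M"
  shows "(\<chi> \<mu>. velocity_operator M \<phi> \<psi> \<rho> E t0 t1 v $ (i, \<mu>, k)) =
    \<rho> *\<^sub>R (mass_primal M \<phi> i *v component_dofs v i k) +
    (1/4) *\<^sub>R (\<Sum>j\<in>faces_of M i. \<Sum>q\<in>UNIV. \<Sum>l\<in>UNIV. \<Sum>m\<in>UNIV. E k q l m *\<^sub>R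
      ((matrix_inv (mass_dual M \<psi> j) *v face_gradient M \<phi> \<psi> t0 t1 v j l m) v*
        Q_matrix M \<phi> \<psi> t0 t1 i j q))"
proof -
  let ?N = "\<lambda>j. matrix_inv (mass_dual M \<psi> j)"
  let ?Q = "Q_matrix M \<phi> \<psi> t0 t1" and ?D = "D_matrix M \<phi> \<psi> t0 t1"
  let ?G = "face_gradient M \<phi> \<psi> t0 t1 v"
  have jump: "(\<Sum>\<nu>\<in>UNIV. ?Q i j m $ \<alpha> $ \<nu> * v $ (i, \<nu>, l)) +
      (\<Sum>\<nu>\<in>UNIV. ?Q (neighbour M i j) j m $ \<alpha> $ \<nu> * v $ (neighbour M i j, \<nu>, l)) = ?G j l m $ \<alpha>"
    if "j \<in> faces_of M i" for j l m \<alpha>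
    using that by (auto simp: faces_of_def neighbour_def face_gradient_def element_gradient_def
        component_dofs_def matrix_vector_mult_def)
  have flux: "(\<Sum>q\<in>UNIV. \<Sum>\<kappa>\<in>UNIV. \<Sum>\<alpha>\<in>UNIV. \<Sum>l\<in>UNIV. \<Sum>m\<in>UNIV.
      ?D i j q $ \<mu> $ \<kappa> * ?N j $ \<kappa> $ \<alpha> * E k q l m * ?G j l m $ \<alpha>) =
      - (\<Sum>q\<in>UNIV. \<Sum>l\<in>UNIV. \<Sum>m\<in>UNIV. E k q l m * ((?N j *v ?G j l m) v* ?Q i j q) $ \<mu>)"
    if j: "j \<in> faces_of M i" for j \<mu>
  proof -
    have "(\<Sum>\<kappa>\<in>UNIV. \<Sum>\<alpha>\<in>UNIV. \<Sum>l\<in>UNIV. \<Sum>m\<in>UNIV.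
        ?D i j q $ \<mu> $ \<kappa> * ?N j $ \<kappa> $ \<alpha> * E k q l m * ?G j l m $ \<alpha>) =
      - (\<Sum>l\<in>UNIV. \<Sum>m\<in>UNIV. E k q l m * ((?N j *v ?G j l m) v* ?Q i j q) $ \<mu>)" for q
    proof -
      let ?f = "\<lambda>\<kappa> \<alpha> l m. ?Q i j q $ \<kappa> $ \<mu> * ?N j $ \<kappa> $ \<alpha> * E k q l m * ?G j l m $ \<alpha>"
      have "(\<Sum>l\<in>UNIV. \<Sum>m\<in>UNIV. E k q l m * ((?N j *v ?G j l m) v* ?Q i j q) $ \<mu>) =
          (\<Sum>l\<in>UNIV. \<Sum>m\<in>UNIV. \<Sum>\<kappa>\<in>UNIV. \<Sum>\<alpha>\<in>UNIV. ?f \<kappa> \<alpha> l m)"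
        by (simp add: matrix_vector_mult_def vector_matrix_mult_def sum_distrib_left mult_ac)
      also have "\<dots> = (\<Sum>\<kappa>\<in>UNIV. \<Sum>\<alpha>\<in>UNIV. \<Sum>l\<in>UNIV. \<Sum>m\<in>UNIV. ?f \<kappa> \<alpha> l m)"
        by (rule sum_swap_pairs)
      finally show ?thesis
        by (simp add: D_matrix_eq_minus_Q_matrix[OF mesh j] sum_negf)
    qed
    then show ?thesis
      by (simp add: sum_negf)
  qed
  have "velocity_operator M \<phi> \<psi> \<rho> E t0 t1 v $ (i, \<mu>, k) =
      \<rho> * (mass_primal M \<phi> i *v component_dofs v i k) $ \<mu> +
      1/4 * (\<Sum>j\<in>faces_of M i. \<Sum>q\<in>UNIV. \<Sum>l\<in>UNIV. \<Sum>m\<in>UNIV.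
        E k q l m * ((?N j *v ?G j l m) v* ?Q i j q) $ \<mu>)" for \<mu>
    by (simp add: velocity_operator_def jump flux sum_negf cong: sum.cong)
      (simp add: matrix_vector_mult_def component_dofs_def)
  then show ?thesis
    by (simp add: vec_eq_iff)
qed

text \<open>
  Testing with \<open>v\<close> moves \<open>Q\<^sup>T\<close> to the left argument of the inner product. Each face then occurs twice,
  with the same right argument and with the element gradients of its two sides on the left, whose sum
  is the gradient on the dual element.
\<close>

lemma velocity_energy:
  fixes M :: "('d::finite, 'e::finite, 'j::finite) mesh"
    and \<phi> :: "'e \<Rightarrow> 'f::finite \<Rightarrow> real^'d \<Rightarrow> real"
    and \<psi> :: "'j \<Rightarrow> 'k::finite \<Rightarrow> real^'d \<Rightarrow> real"
  assumes mesh: "periodic_simplicial_mesh \<Omega> M"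
  shows "v \<bullet> (velocity_matrix M \<phi> \<psi> \<rho> E t0 t1 *v v) =
    \<rho> * (\<Sum>i\<in>UNIV. \<Sum>k\<in>UNIV. component_dofs v i k \<bullet> (mass_primal M \<phi> i *v component_dofs v i k)) +
    1/4 * (\<Sum>j\<in>UNIV. \<Sum>k\<in>UNIV. \<Sum>q\<in>UNIV. \<Sum>l\<in>UNIV. \<Sum>m\<in>UNIV. E k q l m *
      (face_gradient M \<phi> \<psi> t0 t1 v j k q \<bullet>
        (matrix_inv (mass_dual M \<psi> j) *v face_gradient M \<phi> \<psi> t0 t1 v j l m)))"
proof -
  let ?N = "\<lambda>j. matrix_inv (mass_dual M \<psi> j)"
  let ?G = "face_gradient M \<phi> \<psi> t0 t1 v" and ?g = "element_gradient M \<phi> \<psi> t0 t1 v"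
  let ?mass = "\<lambda>i k. component_dofs v i k \<bullet> (mass_primal M \<phi> i *v component_dofs v i k)"
  let ?stress = "\<lambda>i j. \<Sum>k\<in>UNIV. \<Sum>q\<in>UNIV. \<Sum>l\<in>UNIV. \<Sum>m\<in>UNIV.
    E k q l m * (?g i j k q \<bullet> (?N j *v ?G j l m))"
  have adjoint: "x \<bullet> (y v* A) = (A *v x) \<bullet> y" for x :: "real^'f" and y and A :: "real^'f^'k"
    by (metis dot_lmul_matrix inner_commute)
  have "v \<bullet> (velocity_matrix M \<phi> \<psi> \<rho> E t0 t1 *v v) =
      (\<Sum>i\<in>UNIV. \<Sum>k\<in>UNIV. \<Sum>\<mu>\<in>UNIV. v $ (i, \<mu>, k) * velocity_operator M \<phi> \<psi> \<rho> E t0 t1 v $ (i, \<mu>, k))"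
    by (simp add: velocity_matrix_def matrix_works linear_velocity_operator inner_vec_def
        sum_UNIV_triple)
  also have "\<dots> = (\<Sum>i\<in>UNIV. \<Sum>k\<in>UNIV. component_dofs v i k \<bullet>
      (\<chi> \<mu>. velocity_operator M \<phi> \<psi> \<rho> E t0 t1 v $ (i, \<mu>, k)))"
    by (simp add: inner_vec_def component_dofs_def)
  also have "\<dots> = (\<Sum>i\<in>UNIV. \<Sum>k\<in>UNIV. \<rho> * ?mass i k + 1/4 * (\<Sum>j\<in>faces_of M i. \<Sum>q\<in>UNIV.
      \<Sum>l\<in>UNIV. \<Sum>m\<in>UNIV. E k q l m * (?g i j k q \<bullet> (?N j *v ?G j l m))))"
    by (simp add: velocity_operator_component[OF mesh] inner_add_right inner_sum_right
        element_gradient_def adjoint)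
  also have "\<dots> = \<rho> * (\<Sum>i\<in>UNIV. \<Sum>k\<in>UNIV. ?mass i k) + 1/4 * (\<Sum>i\<in>UNIV. \<Sum>j\<in>faces_of M i. ?stress i j)"
    by (simp add: sum.distrib sum_distrib_left sum.swap[of _ "faces_of M _"] flip: sum_divide_distrib)
  also have "(\<Sum>i\<in>UNIV. \<Sum>j\<in>faces_of M i. ?stress i j) =
      (\<Sum>j\<in>UNIV. ?stress (lft M j) j + ?stress (rgt M j) j)"
    by (rule sum_faces_of[OF mesh])
  also have "\<dots> = (\<Sum>j\<in>UNIV. \<Sum>k\<in>UNIV. \<Sum>q\<in>UNIV. \<Sum>l\<in>UNIV. \<Sum>m\<in>UNIV.
      E k q l m * (?G j k q \<bullet> (?N j *v ?G j l m)))"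
    by (simp add: face_gradient_def inner_add_left distrib_left sum.distrib)
  finally show ?thesis .
qed

theorem theorem2:
  fixes \<Omega> :: "(real^'d::finite) set"
    and M :: "('d, 'e::finite, 'j::finite) mesh"
    and \<phi> :: "'e \<Rightarrow> 'f::finite \<Rightarrow> real^'d \<Rightarrow> real"
    and \<psi> :: "'j \<Rightarrow> 'k::finite \<Rightarrow> real^'d \<Rightarrow> real"
    and p :: nat
    and \<rho> t0 t1 :: real
    and E :: "'d \<Rightarrow> 'd \<Rightarrow> 'd \<Rightarrow> 'd \<Rightarrow> real"
    and v :: "real^('e \<times> 'f \<times> 'd)"
  assumes "CARD('d) \<in> {2, 3}"
    and "periodic_simplicial_mesh \<Omega> M"
    and "primal_basis M p \<phi>"
    and "dual_basis M p \<psi>"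
    and "stiffness_tensor E"
    and "\<rho> > 0"
    and "t0 < t1"
    and "v \<noteq> 0"
  shows "v \<bullet> (velocity_matrix M \<phi> \<psi> \<rho> E t0 t1 *v v) > 0"
proof -
  note mesh = assms(2)
  let ?stress = "\<lambda>j. \<Sum>k\<in>UNIV. \<Sum>q\<in>UNIV. \<Sum>l\<in>UNIV. \<Sum>m\<in>UNIV. E k q l m *
    (face_gradient M \<phi> \<psi> t0 t1 v j k q \<bullet>
      (matrix_inv (mass_dual M \<psi> j) *v face_gradient M \<phi> \<psi> t0 t1 v j l m))"
  let ?mass = "\<lambda>i k. component_dofs v i k \<bullet> (mass_primal M \<phi> i *v component_dofs v i k)"
  have mass_pos: "?mass i k > 0" if "component_dofs v i k \<noteq> 0" for i k
  proof -
    have "mass_primal M \<phi> i = gram_matrix (element M i) (\<phi> i)"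
      by (simp add: mass_primal_def gram_matrix_def)
    moreover have "lin_indep_on (element M i) (\<phi> i)" "continuous_on (element M i) (\<phi> i \<mu>)" for \<mu>
      using assms(3) smooth_on_set_imp_continuous_on unfolding primal_basis_def by blast+
    ultimately show ?thesis
      using gram_matrix_positive[OF compact_element element_subset_closure_interior[OF mesh]] that
      by metis
  qed
  have mass_nonneg: "?mass i k \<ge> 0" for i k
    using mass_pos[of i k] by (cases "component_dofs v i k = 0") auto
  have "?stress j \<ge> 0" for j
  proof -
    have "mass_dual M \<psi> j = gram_matrix (dual_element M j) (\<psi> j)"
      by (simp add: mass_dual_def gram_matrix_def)
    moreover have "lin_indep_on (dual_element M j) (\<psi> j)"
        "continuous_on (dual_element M j) (\<psi> j \<kappa>)" for \<kappa>
      using assms(4) smooth_on_set_imp_continuous_on unfolding dual_basis_def by blast+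
    ultimately show ?thesis
      by (simp only:) (intro discrete_energy_nonneg assms(5) compact_dual_element[OF mesh]
          dual_element_subset_closure_interior[OF mesh])
  qed
  then have "(\<Sum>j\<in>UNIV. ?stress j) \<ge> 0"
    by (rule sum_nonneg)
  moreover have "(\<Sum>i\<in>UNIV. \<Sum>k\<in>UNIV. ?mass i k) > 0"
  proof -
    obtain i \<mu> k where "v $ (i, \<mu>, k) \<noteq> 0"
      using \<open>v \<noteq> 0\<close> by (auto simp: vec_eq_iff)
    then have "component_dofs v i k \<noteq> 0"
      by (auto simp: component_dofs_def vec_eq_iff)
    then have "(\<Sum>k\<in>UNIV. ?mass i k) > 0"
      by (intro sum_pos2[where i = k] mass_nonneg mass_pos) auto
    then show ?thesis
      by (intro sum_pos2[where i = i] sum_nonneg mass_nonneg) auto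
  qed
  ultimately show ?thesis
    using \<open>\<rho> > 0\<close> by (simp add: velocity_energy[OF mesh] add_pos_nonneg)
qed

end
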